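(* Let $\beta\in[0,1]$ and let $P\in S(\beta)$. If all the roots of $P$ lie on a line in the complex plane, then $d(P,\beta)\le 1-\frac12\beta(1-\beta)$.
   Context: For $\beta\in[0,1]$, $S(\beta)$ is the set of polynomials of degree at least $2$ with complex coefficients, with all roots in the closed unit disk $\{z\in\mathbb{C}: |z|\le 1\}$, and with at least one root at $\beta$. For $P\in S(\beta)$, $d(P,\beta)$ is the distance between $\beta$ and the closest root of the derivative $P'$, i.e. $d(P,\beta)=\min\{|\zeta-\beta| : P'(\zeta)=0\}$. "A line" means any (real, affine) straight line in $\mathbb{C}\cong\mathbb{R}^2$. *)

theory Defs
  imports
    "HOL-Analysis.Analysis"
    "HOL-Computational_Algebra.Computational_Algebra"
begin

definition S :: "real \<Rightarrow> complex poly set" where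
  "S \<beta> = {P. degree P \<ge> 2 \<and> (\<forall>z. poly P z = 0 \<longrightarrow> cmod z \<le> 1) \<and> poly P (complex_of_real \<beta>) = 0}"

definition d :: "complex poly \<Rightarrow> real \<Rightarrow> real" where
  "d P \<beta> = Min {cmod (\<zeta> - complex_of_real \<beta>) |\<zeta>. poly (pderiv P) \<zeta> = 0}"

text \<open>The minimum is well defined as soon as the degree is at least 2.\<close>

lemma d_set_finite_nonempty:
  fixes P :: "complex poly"
  assumes "degree P \<ge> 2"
  shows "finite {cmod (\<zeta> - complex_of_real \<beta>) |\<zeta>. poly (pderiv P) \<zeta> = 0}"
    and "{cmod (\<zeta> - complex_of_real \<beta>) |\<zeta>. poly (pderiv P) \<zeta> = 0} \<noteq> {}"
proof -
  have deg: "degree (pderiv P) > 0"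
    using assms by (simp add: degree_pderiv)
  then have "finite {\<zeta>. poly (pderiv P) \<zeta> = 0}"
    by (intro poly_roots_finite) auto
  then show "finite {cmod (\<zeta> - complex_of_real \<beta>) |\<zeta>. poly (pderiv P) \<zeta> = 0}"
    by simp
  have "\<not> constant (poly (pderiv P))"
    using deg by (simp add: constant_degree)
  then show "{cmod (\<zeta> - complex_of_real \<beta>) |\<zeta>. poly (pderiv P) \<zeta> = 0} \<noteq> {}"
    using fundamental_theorem_of_algebra by blast
qed

end

theory Submission
  imports Defs
begin

text \<open>
  Why it holds. Put the line in the form \<open>t \<mapsto> \<beta> + t * u\<close> with \<open>cmod u = 1\<close>. Up to a constant
  factor, \<open>P\<close> restricted to the line is then a real polynomial \<open>q\<close> with only real roots, one
  of them \<open>0\<close> and the others the elements of a nonempty multiset \<open>T\<close>, and a critical point \<open>x\<close>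
  of \<open>q\<close> yields a critical point of \<open>P\<close> at distance \<open>\<bar>x\<bar>\<close> from \<open>\<beta>\<close>.

  As long as \<open>q'\<close> has no zero in \<open>[-\<bar>x\<bar>, \<bar>x\<bar>]\<close>, \<open>q\<close> is strictly monotone there and vanishes
  only at \<open>0\<close>, so \<open>x q'(x) / q(x) > 0\<close>; expanding the logarithmic derivative, this says
  \<open>\<Sum> x / (t - x) < 1\<close>, the sum running over \<open>T\<close> (\<open>critical_free_sum_less_1\<close>). Choosing \<open>x\<close>
  well produces critical points near \<open>0\<close>:

  \<^item> If all of \<open>T\<close> lies on one side of \<open>0\<close> and \<open>s\<close> belongs to it, take \<open>x = s / 2\<close>. The term
    of \<open>s\<close> is already \<open>1\<close> and no term is negative, so \<open>q\<close> has a critical point in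
    \<open>[-\<bar>s\<bar>/2, \<bar>s\<bar>/2]\<close>. Since \<open>\<beta> + s * u\<close> is in the unit disk, \<open>\<bar>s\<bar> \<le> 1 + \<beta>\<close>, and
    \<open>(1 + \<beta>) / 2\<close> differs from the claimed bound by \<open>(1 - \<beta>)\<^sup>2 / 2\<close>.

  \<^item> For any \<open>s\<close> in \<open>T\<close>, add the two inequalities at \<open>x = \<plusminus>\<bar>s\<bar>/\<surd>2\<close>. The summands
    become \<open>2 x\<^sup>2 / (t\<^sup>2 - x\<^sup>2) > 0\<close>, and the one of \<open>s\<close> is \<open>2\<close>, so \<open>q\<close> has a critical point
    in \<open>[-\<bar>s\<bar>/\<surd>2, \<bar>s\<bar>/\<surd>2]\<close>. If \<open>T\<close> does not lie on one side of \<open>0\<close>, some \<open>s\<close> in \<open>T\<close>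
    does not lead from \<open>\<beta>\<close> towards the origin (\<open>opposite_points_in_disk\<close>); it has
    \<open>s\<^sup>2 \<le> 1 - \<beta>\<^sup>2\<close>, and \<open>1/\<surd>2\<close> is less than \<open>7/8\<close>, the least value of the claimed bound.
\<close>

section \<open>Critical points of real-rooted polynomials near a root\<close>

lemma poly_pderiv_linear_mult:
  fixes x :: "'a::idom"
  shows "poly (pderiv ([:-a, 1:] * p)) x = poly p x + (x - a) * poly (pderiv p) x"
  unfolding pderiv_mult by (simp add: pderiv_pCons algebra_simps)

lemma poly_pderiv_prod_mset_linear:
  fixes x :: "'a::field_char_0"
  assumes "x \<notin># A"
  shows "poly (pderiv (\<Prod>a\<in>#A. [:-a, 1:])) x =
    poly (\<Prod>a\<in>#A. [:-a, 1:]) x * (\<Sum>a\<in>#A. 1 / (x - a))"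
  using assms
proof (induction A)
  case (add a A)
  then show ?case
    by (auto simp: poly_pderiv_linear_mult field_simps simp del: mult_pCons_left)
qed simp

text \<open>
  By the mean value theorem \<open>p x = x * p' \<xi>\<close>, and a derivative without zeros keeps its sign.
\<close>

lemma deriv_times_value_pos:
  fixes p :: "real poly"
  assumes p0: "poly p 0 = 0" and x: "x \<noteq> 0"
    and nz: "\<And>y. \<bar>y\<bar> \<le> \<bar>x\<bar> \<Longrightarrow> poly (pderiv p) y \<noteq> 0"
  shows "0 < x * poly (pderiv p) x * poly p x"
proof -
  obtain \<xi> where \<xi>: "\<xi> \<in> {min 0 x..max 0 x}" "poly p x = x * poly (pderiv p) \<xi>"
    using poly_MVT'[of 0 x "{min 0 x..max 0 x}" p] p0 by auto
  have "\<not> poly (pderiv p) \<xi> * poly (pderiv p) x < 0"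
  proof
    assume neg: "poly (pderiv p) \<xi> * poly (pderiv p) x < 0"
    have "\<exists>y. \<bar>y\<bar> \<le> \<bar>x\<bar> \<and> poly (pderiv p) y = 0"
    proof (cases \<xi> x rule: linorder_cases)
      case less
      then obtain y where "\<xi> < y" "y < x" "poly (pderiv p) y = 0"
        using poly_IVT neg by blast
      then show ?thesis using \<xi>(1) by (intro exI[of _ y]) auto
    next
      case greater
      then obtain y where "x < y" "y < \<xi>" "poly (pderiv p) y = 0"
        using poly_IVT[of x \<xi>] neg by (auto simp: mult.commute)
      then show ?thesis using \<xi>(1) by (intro exI[of _ y]) auto
    next
      case equal
      then show ?thesis using neg not_square_less_zero by auto
    qed
    then show False using nz by blast
  qed
  moreover have "\<bar>\<xi>\<bar> \<le> \<bar>x\<bar>"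
    using \<xi>(1) by auto
  then have "poly (pderiv p) \<xi> * poly (pderiv p) x \<noteq> 0"
    using nz by simp
  ultimately have "0 < poly (pderiv p) \<xi> * poly (pderiv p) x"
    by linarith
  then have "0 < x\<^sup>2 * (poly (pderiv p) \<xi> * poly (pderiv p) x)"
    using x by simp
  then show ?thesis
    by (simp add: \<xi>(2) power2_eq_square mult_ac)
qed

text \<open>
  One copy of the root \<open>0\<close> is set apart from \<open>T\<close>, so that \<open>0 \<in># T\<close> means a multiple root at \<open>0\<close>.
\<close>

definition critical_free :: "real multiset \<Rightarrow> real \<Rightarrow> bool" where
  "critical_free T r \<longleftrightarrow>
    (\<forall>y. \<bar>y\<bar> \<le> r \<longrightarrow> poly (pderiv (\<Prod>t\<in>#add_mset 0 T. [:-t, 1:])) y \<noteq> 0)"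

text \<open>
  A second root within distance \<open>r\<close> of \<open>0\<close> would contradict \<open>deriv_times_value_pos\<close>, or make
  \<open>0\<close> a double root, which is itself critical.
\<close>

lemma critical_free_abs_gt:
  assumes "critical_free T r" "0 \<le> r" "t \<in># T"
  shows "r < \<bar>t\<bar>"
proof (rule ccontr)
  assume "\<not> r < \<bar>t\<bar>"
  then have le: "\<bar>t\<bar> \<le> r" by simp
  define q where "q = (\<Prod>t\<in>#add_mset 0 T. [:-t, 1:])"
  have nz: "poly (pderiv q) y \<noteq> 0" if "\<bar>y\<bar> \<le> r" for y
    using assms(1) that unfolding critical_free_def q_def by blast
  have root: "poly (\<Prod>t\<in>#T. [:-t, 1:]) t = 0"
    using assms(3) by (auto simp: poly_prod_mset)
  show False
  proof (cases "t = 0")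
    case True
    then have "poly (pderiv q) 0 = 0"
      using root by (simp add: q_def pderiv_mult pderiv_pCons)
    then show False using nz[of 0] assms(2) by simp
  next
    case False
    have "poly q 0 = 0" "poly q t = 0"
      using root by (simp_all add: q_def)
    then show False
      using deriv_times_value_pos[of q t] False nz le by force
  qed
qed

lemma critical_free_sum_less_1:
  assumes free: "critical_free T \<bar>x\<bar>" and x: "x \<noteq> 0"
  shows "(\<Sum>t\<in>#T. x / (t - x)) < 1"
proof -
  define q where "q = (\<Prod>t\<in>#add_mset 0 T. [:-t, 1:])"
  define s where "s = (\<Sum>t\<in>#add_mset 0 T. 1 / (x - t))"
  have "x \<notin># add_mset 0 T"
    using critical_free_abs_gt[OF free, of x] x by auto
  then have log_deriv: "poly (pderiv q) x = poly q x * s"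
    unfolding q_def s_def by (rule poly_pderiv_prod_mset_linear)
  have "0 < x * poly (pderiv q) x * poly q x"
    using free x by (intro deriv_times_value_pos) (auto simp: critical_free_def q_def)
  then have "0 < (x * s) * (poly q x)\<^sup>2"
    by (simp add: log_deriv power2_eq_square mult_ac)
  then have "0 < x * s"
    by (simp add: zero_less_mult_iff)
  moreover have "x * (\<Sum>t\<in>#T. 1 / (x - t)) = - (\<Sum>t\<in>#T. x / (t - x))"
    by (induction T) (simp_all add: algebra_simps minus_divide_right)
  then have "x * s = 1 - (\<Sum>t\<in>#T. x / (t - x))"
    using x by (simp add: s_def distrib_left)
  ultimately show ?thesis by simp
qed

lemma sum_mset_ge_member:
  fixes f :: "'a \<Rightarrow> real"
  assumes "s \<in># T" "\<And>t. t \<in># T \<Longrightarrow> 0 \<le> f t"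
  shows "f s \<le> (\<Sum>t\<in>#T. f t)"
proof -
  obtain R where R: "T = add_mset s R"
    using assms(1) by (metis multi_member_split)
  have "0 \<le> (\<Sum>t\<in>#R. f t)"
    using sum_mset_mono[of R "\<lambda>_. 0" f] assms(2) R by simp
  then show ?thesis by (simp add: R)
qed

text \<open>
  The value \<open>s / 2\<close> is optimal: it is the critical point of \<open>t * (t - s)\<close>.
\<close>

lemma critical_point_one_sided:
  assumes s: "s \<in># T" and side: "\<And>t. t \<in># T \<Longrightarrow> 0 < t * s"
  shows "\<not> critical_free T (\<bar>s\<bar> / 2)"
proof
  assume free: "critical_free T (\<bar>s\<bar> / 2)"
  have s0: "s \<noteq> 0" using side[OF s] by auto
  have nonneg: "0 \<le> (s/2) / (t - s/2)" if "t \<in># T" for t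
  proof -
    have "\<bar>s\<bar> / 2 < \<bar>t\<bar>"
      using critical_free_abs_gt[OF free _ that] by simp
    with side[OF that] show ?thesis
      by (auto simp: zero_less_mult_iff zero_le_divide_iff)
  qed
  have "(s/2) / (s - s/2) \<le> (\<Sum>t\<in>#T. (s/2) / (t - s/2))"
    using s nonneg by (rule sum_mset_ge_member)
  moreover have "(s/2) / (s - s/2) = 1"
    using s0 by (simp add: field_simps)
  moreover have "(\<Sum>t\<in>#T. (s/2) / (t - s/2)) < 1"
    using free s0 by (intro critical_free_sum_less_1) simp_all
  ultimately show False by simp
qed

text \<open>
  Adding the inequalities at \<open>r\<close> and \<open>-r\<close> makes every summand positive, whatever the signs of
  the roots.
\<close>

lemma critical_point_two_sided:
  assumes s: "s \<in># T"
  shows "\<not> critical_free T (\<bar>s\<bar> / sqrt 2)"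
proof
  define r where "r = \<bar>s\<bar> / sqrt 2"
  assume "critical_free T (\<bar>s\<bar> / sqrt 2)"
  then have free: "critical_free T r" by (simp add: r_def)
  have r0: "0 \<le> r" by (simp add: r_def)
  have "s \<noteq> 0"
    using critical_free_abs_gt[OF free r0 s] r0 by auto
  then have r: "0 < r" by (simp add: r_def)
  have s2: "s\<^sup>2 = 2 * r\<^sup>2" by (simp add: r_def power_divide)
  have gt: "r\<^sup>2 < t\<^sup>2" if "t \<in># T" for t
    using power_strict_mono[OF critical_free_abs_gt[OF free r0 that] r0, of 2] by simp
  have pair: "r / (t - r) + (- r) / (t - (- r)) = 2 * r\<^sup>2 / (t\<^sup>2 - r\<^sup>2)" if "t \<in># T" for t
  proof -
    have "t - r \<noteq> 0" "t + r \<noteq> 0"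
      using critical_free_abs_gt[OF free r0 that] r0 by auto
    moreover have "t\<^sup>2 - r\<^sup>2 = (t - r) * (t + r)"
      by (simp add: power2_eq_square algebra_simps)
    ultimately show ?thesis
      by (simp add: divide_simps) (simp add: power2_eq_square algebra_simps)
  qed
  have "2 = 2 * r\<^sup>2 / (s\<^sup>2 - r\<^sup>2)"
    using r by (simp add: s2)
  also have "\<dots> \<le> (\<Sum>t\<in>#T. 2 * r\<^sup>2 / (t\<^sup>2 - r\<^sup>2))"
    using s by (rule sum_mset_ge_member) (use gt in \<open>force intro!: divide_nonneg_pos\<close>)
  also have "\<dots> = (\<Sum>t\<in>#T. r / (t - r) + (- r) / (t - (- r)))"
    by (intro arg_cong[of _ _ sum_mset] image_mset_cong) (simp only: pair)
  also have "\<dots> = (\<Sum>t\<in>#T. r / (t - r)) + (\<Sum>t\<in>#T. (- r) / (t - (- r)))"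
    by (rule sum_mset.distrib)
  also have "\<dots> < 1 + 1"
    using free r by (intro add_strict_mono critical_free_sum_less_1) simp_all
  finally show False by simp
qed

section \<open>Polynomials with collinear roots\<close>

text \<open>
  The derivative is carried along because the induction step of the product rule needs the
  values of both the product and its derivative.
\<close>

lemma poly_prod_roots_on_line:
  fixes b u :: complex and x :: real
  shows "poly (\<Prod>t\<in>#T. [:-(b + of_real t * u), 1:]) (b + of_real x * u) =
      u ^ size T * of_real (poly (\<Prod>t\<in>#T. [:-t, 1:]) x)" (is ?value)
    and "u * poly (pderiv (\<Prod>t\<in>#T. [:-(b + of_real t * u), 1:])) (b + of_real x * u) =
      u ^ size T * of_real (poly (pderiv (\<Prod>t\<in>#T. [:-t, 1:])) x)" (is ?deriv)
proof -
  have "?value \<and> ?deriv"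
  proof (induction T)
    case (add t T)
    let ?Q = "\<Prod>t\<in>#T. [:-(b + of_real t * u), 1:]" and ?q = "\<Prod>t\<in>#T. [:-t, 1:]"
    let ?z = "b + of_real x * u"
    have val: "poly ?Q ?z = u ^ size T * of_real (poly ?q x)"
      and der: "u * poly (pderiv ?Q) ?z = u ^ size T * of_real (poly (pderiv ?q) x)"
      using add.IH by simp_all
    have "u * poly (pderiv (\<Prod>t\<in>#add_mset t T. [:-(b + of_real t * u), 1:])) ?z =
        u * poly ?Q ?z + of_real (x - t) * u * (u * poly (pderiv ?Q) ?z)"
      by (simp only: image_mset_add_mset prod_mset.add_mset poly_pderiv_linear_mult)
        (simp add: algebra_simps)
    also have "\<dots> = u ^ size (add_mset t T) *
        of_real (poly (pderiv (\<Prod>t\<in>#add_mset t T. [:-t, 1:])) x)"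
      unfolding val der
      by (simp only: image_mset_add_mset prod_mset.add_mset poly_pderiv_linear_mult)
        (simp add: algebra_simps)
    finally show ?case
      using val by (simp add: algebra_simps)
  qed simp
  then show ?value ?deriv by simp_all
qed

text \<open>
  The definition of collinearity also allows a zero direction, which can happen when \<open>A\<close> is a
  single point; any unit vector serves then.
\<close>

lemma collinear_unit_direction:
  fixes A :: "complex set"
  assumes "collinear A" "b \<in> A"
  obtains u where "cmod u = 1" "\<And>z. z \<in> A \<Longrightarrow> \<exists>t. z = b + of_real t * u"
proof -
  obtain v where v: "\<And>z. z \<in> A \<Longrightarrow> \<exists>c. z - b = c *\<^sub>R v"
    using assms unfolding collinear_def by blast
  define u where "u = (if v = 0 then 1 else sgn v)"
  have vu: "v = of_real (cmod v) * u"
    by (simp add: u_def sgn_div_norm scaleR_conv_of_real)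
  show thesis
  proof
    show "cmod u = 1" by (simp add: u_def norm_sgn)
    fix z assume "z \<in> A"
    then obtain c where "z - b = c *\<^sub>R v" using v by blast
    then have "z = b + of_real (c * cmod v) * u"
      using vu by (simp add: scaleR_conv_of_real algebra_simps)
    then show "\<exists>t. z = b + of_real t * u" by blast
  qed
qed

lemma collinear_roots_factorization:
  fixes P :: "complex poly"
  assumes deg: "degree P \<ge> 2" and root: "poly P b = 0" and line: "collinear {z. poly P z = 0}"
  obtains u T where "cmod u = 1" "T \<noteq> {#}"
    "P = smult (lead_coeff P) (\<Prod>t\<in>#add_mset 0 T. [:-(b + of_real t * u), 1:])"
proof -
  have P0: "P \<noteq> 0" using deg by auto
  obtain u where u: "cmod u = 1"
    and ex: "\<And>z. poly P z = 0 \<Longrightarrow> \<exists>t. z = b + of_real t * u"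
    using collinear_unit_direction[OF line, of b] root by auto
  then obtain \<tau> where \<tau>: "\<And>z. poly P z = 0 \<Longrightarrow> z = b + of_real (\<tau> z) * u"
    by metis
  obtain A where size: "size A = degree P"
    and P: "P = smult (lead_coeff P) (\<Prod>z\<in>#A. [:-z, 1:])"
    using alg_closed_imp_factorization[OF P0] by blast
  have A_iff: "z \<in># A \<longleftrightarrow> poly P z = 0" for z
    using P0 by (subst P) (auto simp: poly_prod_mset)
  obtain B where B: "A = add_mset b B"
    using A_iff[of b] root by (auto dest: multi_member_split)
  have B_eq: "image_mset (\<lambda>z. b + of_real (\<tau> z) * u) B = B"
  proof -
    have "image_mset (\<lambda>z. b + of_real (\<tau> z) * u) B = image_mset (\<lambda>z. z) B"
    proof (rule image_mset_cong)
      fix z assume "z \<in># B"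
      then have "poly P z = 0" using A_iff[of z] B by simp
      then show "b + of_real (\<tau> z) * u = z" by (rule \<tau>[symmetric])
    qed
    then show ?thesis by simp
  qed
  have "(\<Prod>t\<in>#add_mset 0 (image_mset \<tau> B). [:-(b + of_real t * u), 1:]) =
      (\<Prod>z\<in>#add_mset b (image_mset (\<lambda>z. b + of_real (\<tau> z) * u) B). [:-z, 1:])"
    by (simp add: image_mset.compositionality o_def)
  also have "\<dots> = (\<Prod>z\<in>#A. [:-z, 1:])"
    unfolding B_eq B ..
  finally have "P = smult (lead_coeff P)
      (\<Prod>t\<in>#add_mset 0 (image_mset \<tau> B). [:-(b + of_real t * u), 1:])"
    using P by argo
  moreover have "image_mset \<tau> B \<noteq> {#}"
    using size B deg by auto
  ultimately show thesis using that u by blast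
qed

lemma d_le_if_not_critical_free:
  fixes P :: "complex poly"
  assumes deg: "degree P \<ge> 2" and u: "cmod u = 1"
    and P: "P = smult c (\<Prod>t\<in>#add_mset 0 T. [:-(of_real \<beta> + of_real t * u), 1:])"
    and crit: "\<not> critical_free T r"
  shows "d P \<beta> \<le> r"
proof -
  obtain x where x: "\<bar>x\<bar> \<le> r" "poly (pderiv (\<Prod>t\<in>#add_mset 0 T. [:-t, 1:])) x = 0"
    using crit unfolding critical_free_def by blast
  let ?z = "of_real \<beta> + of_real x * u"
  have "u \<noteq> 0" using u by auto
  then have "poly (pderiv (\<Prod>t\<in>#add_mset 0 T. [:-(of_real \<beta> + of_real t * u), 1:])) ?z = 0"
    using poly_prod_roots_on_line(2)[of u "of_real \<beta>" "add_mset 0 T" x] x(2)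
    by (metis mult_eq_0_iff of_real_0)
  then have "poly (pderiv P) ?z = 0"
    by (subst P) (simp only: pderiv_smult poly_smult mult_zero_right)
  then have "cmod (?z - of_real \<beta>) \<in> {cmod (\<zeta> - of_real \<beta>) |\<zeta>. poly (pderiv P) \<zeta> = 0}"
    by blast
  then have "d P \<beta> \<le> cmod (?z - of_real \<beta>)"
    unfolding d_def using d_set_finite_nonempty(1)[OF deg] by (intro Min_le)
  also have "\<dots> = \<bar>x\<bar>"
    using u by (simp add: norm_mult)
  finally show ?thesis using x(1) by simp
qed

section \<open>The bound for roots in the unit disk\<close>

text \<open>
  Expanding, \<open>cmod (\<beta> + t * u)\<^sup>2 = \<beta>\<^sup>2 + 2 * \<beta> * t * Re u + t\<^sup>2\<close>, and one of \<open>s\<close>, \<open>t\<close> has the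
  sign that makes the middle term nonnegative.
\<close>

lemma opposite_points_in_disk:
  assumes \<beta>: "0 \<le> \<beta>" and u: "cmod u = 1" and opp: "t * s \<le> 0"
    and disk: "cmod (of_real \<beta> + of_real s * u) \<le> 1" "cmod (of_real \<beta> + of_real t * u) \<le> 1"
  shows "\<bar>s\<bar> \<le> 1 \<or> \<bar>t\<bar> \<le> 1"
proof -
  have "x\<^sup>2 \<le> 1 - 2 * \<beta> * (x * Re u)" if "cmod (of_real \<beta> + of_real x * u) \<le> 1" for x
  proof -
    have "(cmod (of_real \<beta> + of_real x * u))\<^sup>2 = (\<beta> + x * Re u)\<^sup>2 + (x * Im u)\<^sup>2"
      by (simp add: cmod_power2)
    also have "\<dots> = \<beta>\<^sup>2 + 2 * \<beta> * (x * Re u) + x\<^sup>2 * ((Re u)\<^sup>2 + (Im u)\<^sup>2)"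
      by (simp add: power2_eq_square algebra_simps)
    also have "(Re u)\<^sup>2 + (Im u)\<^sup>2 = 1"
      using u cmod_power2[of u] by simp
    finally have "\<beta>\<^sup>2 + 2 * \<beta> * (x * Re u) + x\<^sup>2 \<le> 1"
      using power_mono[OF that norm_ge_zero, of 2] by simp
    then show ?thesis using zero_le_power2[of \<beta>] by linarith
  qed
  note bound = this
  have "0 \<le> x * Re u \<Longrightarrow> cmod (of_real \<beta> + of_real x * u) \<le> 1 \<Longrightarrow> \<bar>x\<bar> \<le> 1" for x
    using bound[of x] mult_nonneg_nonneg[OF \<beta>, of "x * Re u"] by (auto simp flip: abs_square_le_1)
  moreover have "0 \<le> s * Re u \<or> 0 \<le> t * Re u"
    using opp by (auto simp: zero_le_mult_iff mult_le_0_iff)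
  ultimately show ?thesis using disk by blast
qed

theorem theorem7:
  fixes \<beta> :: real and P :: "complex poly" and L :: "complex set"
  assumes "\<beta> \<in> {0..1}"
    and "P \<in> S \<beta>"
    and "affine L" and "aff_dim L = 1"
    and "{z. poly P z = 0} \<subseteq> L"
  shows "d P \<beta> \<le> 1 - 1 / 2 * \<beta> * (1 - \<beta>)"
proof -
  have \<beta>: "0 \<le> \<beta>" "\<beta> \<le> 1" using assms(1) by auto
  have deg: "degree P \<ge> 2" and root: "poly P (of_real \<beta>) = 0"
    and disk: "\<And>z. poly P z = 0 \<Longrightarrow> cmod z \<le> 1"
    using assms(2) by (auto simp: S_def)
  have "collinear {z. poly P z = 0}"
    using aff_dim_subset[OF assms(5)] assms(4) by (simp add: collinear_aff_dim)
  then obtain u T where u: "cmod u = 1" and T: "T \<noteq> {#}"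
    and P: "P = smult (lead_coeff P) (\<Prod>t\<in>#add_mset 0 T. [:-(of_real \<beta> + of_real t * u), 1:])"
    using collinear_roots_factorization[OF deg root] by blast
  note d_le = d_le_if_not_critical_free[OF deg u P]
  have T_disk: "cmod (of_real \<beta> + of_real t * u) \<le> 1" if "t \<in># T" for t
  proof (rule disk)
    show "poly P (of_real \<beta> + of_real t * u) = 0"
      by (subst P) (use that in \<open>auto simp: poly_prod_mset\<close>)
  qed
  obtain s where s: "s \<in># T" using T by blast
  show ?thesis
  proof (cases "\<forall>t\<in>#T. 0 < t * s")
    case True
    then have "d P \<beta> \<le> \<bar>s\<bar> / 2"
      using critical_point_one_sided[OF s] d_le by blast
    also have "\<bar>s\<bar> \<le> 1 + \<beta>"
      using norm_triangle_ineq4[of "of_real \<beta> + of_real s * u" "of_real \<beta>"] T_disk[OF s] u \<beta>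
      by (simp add: norm_mult)
    also have "(1 + \<beta>) / 2 \<le> 1 - 1 / 2 * \<beta> * (1 - \<beta>)"
      using zero_le_power2[of "1 - \<beta>"] by (simp add: power2_eq_square field_simps)
    finally show ?thesis by simp
  next
    case False
    then obtain t where t: "t \<in># T" "t * s \<le> 0" by (auto simp: not_less)
    then obtain r where r: "r \<in># T" "\<bar>r\<bar> \<le> 1"
      using opposite_points_in_disk[OF \<beta>(1) u t(2)] T_disk s by blast
    have "d P \<beta> \<le> \<bar>r\<bar> / sqrt 2"
      using critical_point_two_sided[OF r(1)] by (rule d_le)
    also have "\<dots> \<le> 1 / sqrt 2"
      using r(2) by (simp add: divide_right_mono)
    also have "\<dots> \<le> 7 / 8"
    proof -
      have "8 / 7 \<le> sqrt 2"
        by (rule real_le_rsqrt) (simp add: power2_eq_square)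
      then show ?thesis by (simp add: field_simps)
    qed
    also have "\<dots> \<le> 1 - 1 / 2 * \<beta> * (1 - \<beta>)"
      using zero_le_power2[of "\<beta> - 1 / 2"] by (simp add: power2_eq_square field_simps)
    finally show ?thesis .
  qed
qed

end
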